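(* Let $m\ge 1$ and $n\ge 2$ be integers. For any real $s\ge \frac{1}{n-1}$, the map $\mathrm{Exp}$ restricts to a bijection $$\mathrm{Exp}:\mathfrak X_{n}(\mathbb C^m,0)_s\to \mathrm{Diff}_{n-1}(\mathbb C^m,0)_s.$$ In particular, the infinitesimal generator of any analytic (i.e. convergent) diffeomorphism $F$ of $(\mathbb C^m,0)$ tangent to the identity is $\frac{1}{\nu(F)}$-Gevrey.
   Context: Let $x=(x_1,\dots,x_m)$, let $\mathbb C[[x]]$ be the ring of formal power series and $\mathbb C\{x\}$ the subring of convergent ones; $\nu_0$ denotes the order (lowest degree of a nonzero homogeneous term, with $\nu_0(0)=\infty$). For an integer $n\ge 2$, $\hat{\mathfrak X}_n(\mathbb C^m,0)$ is the module of formal vector fields $X=\sum_{k=1}^m X(x_k)\frac{\partial}{\partial x_k}$ of order $\ge n$, i.e. $\nu_0(X(x_k))\ge n$ for all $k$. For a formal diffeomorphism $F$ of $(\mathbb C^m,0)$ put $\nu(F)=\min\{\nu_0(x_i\circ F-x_i)\mid i=1,\dots,m\}-1$. $F$ is tangent to the identity if $\nu(F)\ge 1$. For an integer $n\ge 1$, $\widehat{\mathrm{Diff}}_n(\mathbb C^m,0)$ is the group of formal diffeomorphisms with $\nu(F)\ge n$ (tangent to the identity of order $\ge n$). For $F$ the identity, $\nu(F)=\infty$ and $1/\nu(F)$ is read as $0$. For $X\in\hat{\mathfrak X}_n(\mathbb C^m,0)$ with $n\ge 2$ and $g\in\mathbb C[[x]]$, set $\exp X(g)=\sum_{j=0}^\infty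 \frac{1}{j!}X^j(g)$, where $X^0(g)=g$ and $X^{j+1}(g)=X(X^j(g))$. The map $\mathrm{Exp}:\hat{\mathfrak X}_n(\mathbb C^m,0)\to\widehat{\mathrm{Diff}}_{n-1}(\mathbb C^m,0)$, $X\mapsto(\exp X(x_1),\dots,\exp X(x_m))$, is (classically) a bijection; the unique $X$ with $F=\mathrm{Exp}(X)$ is called the infinitesimal generator of $F$. For $s\in\mathbb R$, a series $f=\sum_{k\ge 0}f_k\in\mathbb C[[x]]$, with $f_k$ homogeneous of degree $k$, is $s$-Gevrey, written $f\in\mathbb C[[x]]_s$, if $\sum_{k\ge0}\frac{f_k(x)}{(k!)^s}\in\mathbb C\{x\}$. Then $\mathfrak X_n(\mathbb C^m,0)_s$ is the set of $X\in\hat{\mathfrak X}_n(\mathbb C^m,0)$ with $X(x_k)\in\mathbb C[[x]]_s$ for all $k$ (the $s$-Gevrey vector fields), and $\mathrm{Diff}_n(\mathbb C^m,0)_s=\widehat{\mathrm{Diff}}_n(\mathbb C^m,0)\cap(\mathbb C[[x]]_s)^m$. *)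

theory Defs
  imports "HOL-Analysis.Analysis" "HOL-Library.Extended_Nat"
begin

section \<open>The ring of formal power series in several variables\<close>

text \<open>
  The variables are indexed by a finite type \<open>'m\<close>, so that $m = $ \<open>CARD('m)\<close>, which is an
  arbitrary integer $\ge 1$.  A multi-index is a vector \<open>\<alpha> :: nat ^ 'm\<close>, and a series is
  given by the family of its coefficients.
\<close>

typedef (overloaded) 'm mfps = "UNIV :: ((nat ^ 'm::finite) \<Rightarrow> complex) set"
  morphisms mcoeff Abs_mfps
  by simp

setup_lifting type_definition_mfps

lemma mfps_eqI: "(\<And>\<alpha>. mcoeff f \<alpha> = mcoeff g \<alpha>) \<Longrightarrow> f = g"
  by transfer auto

definition mdeg :: "nat ^ 'm::finite \<Rightarrow> nat" where
  "mdeg \<alpha> = (\<Sum>i\<in>UNIV. \<alpha> $ i)"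

lemma mdeg_add [simp]: "mdeg (\<alpha> + \<beta>) = mdeg \<alpha> + mdeg \<beta>"
  by (simp add: mdeg_def sum.distrib)

lemma mdeg_zero [simp]: "mdeg 0 = 0"
  by (simp add: mdeg_def)

lemma mdeg_axis [simp]: "mdeg (axis k c) = c"
  by (simp add: mdeg_def axis_def)

lemma finite_sum_eq [simp]: "finite {(\<beta>, \<gamma>). \<beta> + \<gamma> = (\<alpha> :: nat ^ 'm::finite)}"
proof (rule finite_subset)
  let ?B = "vec_lambda ` (Pi\<^sub>E UNIV (\<lambda>i. {..\<alpha> $ i})) :: (nat ^ 'm) set"
  have mem: "\<beta> \<in> ?B" if "\<forall>i. \<beta> $ i \<le> \<alpha> $ i" for \<beta>
    using that by (intro image_eqI[where x = "vec_nth \<beta>"]) auto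
  show "{(\<beta>, \<gamma>). \<beta> + \<gamma> = \<alpha>} \<subseteq> ?B \<times> ?B"
  proof (rule subrelI)
    fix \<beta> \<gamma> :: "nat ^ 'm" assume "(\<beta>, \<gamma>) \<in> {(\<beta>, \<gamma>). \<beta> + \<gamma> = \<alpha>}"
    then have "\<alpha> = \<beta> + \<gamma>" by simp
    then have "\<beta> \<in> ?B" "\<gamma> \<in> ?B" by (intro mem; simp)+
    then show "(\<beta>, \<gamma>) \<in> ?B \<times> ?B" by blast
  qed
  show "finite (?B \<times> ?B)"
    by (intro finite_cartesian_product finite_imageI finite_PiE) auto
qed

instantiation mfps :: (finite) comm_ring_1
begin

lift_definition zero_mfps :: "'a mfps" is "\<lambda>_. 0" .

lift_definition one_mfps :: "'a mfps" is "\<lambda>\<alpha>. if \<alpha> = 0 then 1 else 0" .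

lift_definition plus_mfps :: "'a mfps \<Rightarrow> 'a mfps \<Rightarrow> 'a mfps" is "\<lambda>f g \<alpha>. f \<alpha> + g \<alpha>" .

lift_definition minus_mfps :: "'a mfps \<Rightarrow> 'a mfps \<Rightarrow> 'a mfps" is "\<lambda>f g \<alpha>. f \<alpha> - g \<alpha>" .

lift_definition uminus_mfps :: "'a mfps \<Rightarrow> 'a mfps" is "\<lambda>f \<alpha>. - f \<alpha>" .

lift_definition times_mfps :: "'a mfps \<Rightarrow> 'a mfps \<Rightarrow> 'a mfps" is
  "\<lambda>f g \<alpha>. \<Sum>(\<beta>, \<gamma>) | \<beta> + \<gamma> = \<alpha>. f \<beta> * g \<gamma>" .

instance
proof
  fix f g h :: "'a mfps"
  show "f * g * h = f * (g * h)"
  proof (transfer, rule ext)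
    fix f g h :: "nat ^ 'a \<Rightarrow> complex" and \<alpha>
    let ?S = "\<lambda>\<alpha> :: nat ^ 'a. {(\<beta>, \<gamma>). \<beta> + \<gamma> = \<alpha>}"
    have "(\<Sum>(\<beta>, \<gamma>)\<in>?S \<alpha>. (\<Sum>(\<delta>, \<epsilon>)\<in>?S \<beta>. f \<delta> * g \<epsilon>) * h \<gamma>)
        = (\<Sum>((\<beta>, \<gamma>), (\<delta>, \<epsilon>))\<in>Sigma (?S \<alpha>) (\<lambda>(\<beta>, \<gamma>). ?S \<beta>). f \<delta> * g \<epsilon> * h \<gamma>)"
      using finite_sum_eq
      by (subst sum.Sigma [symmetric])
        (auto simp: sum_distrib_right case_prod_unfold intro!: sum.cong)
    also have "\<dots> = (\<Sum>((\<beta>, \<gamma>), (\<delta>, \<epsilon>))\<in>Sigma (?S \<alpha>) (\<lambda>(\<beta>, \<gamma>). ?S \<gamma>). f \<beta> * (g \<delta> * h \<epsilon>))"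
      by (rule sum.reindex_bij_witness [where
            i = "\<lambda>((\<beta>, \<gamma>), (\<delta>, \<epsilon>)). ((\<beta> + \<delta>, \<epsilon>), (\<beta>, \<delta>))" and
            j = "\<lambda>((\<beta>, \<gamma>), (\<delta>, \<epsilon>)). ((\<delta>, \<epsilon> + \<gamma>), (\<epsilon>, \<gamma>))"])
        (auto simp: add.assoc mult.assoc)
    also have "\<dots> = (\<Sum>(\<beta>, \<gamma>)\<in>?S \<alpha>. f \<beta> * (\<Sum>(\<delta>, \<epsilon>)\<in>?S \<gamma>. g \<delta> * h \<epsilon>))"
      using finite_sum_eq
      by (subst sum.Sigma [symmetric])
        (auto simp: sum_distrib_left case_prod_unfold intro!: sum.cong)
    finally show "(\<Sum>(\<beta>, \<gamma>)\<in>?S \<alpha>. (\<Sum>(\<delta>, \<epsilon>)\<in>?S \<beta>. f \<delta> * g \<epsilon>) * h \<gamma>)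
        = (\<Sum>(\<beta>, \<gamma>)\<in>?S \<alpha>. f \<beta> * (\<Sum>(\<delta>, \<epsilon>)\<in>?S \<gamma>. g \<delta> * h \<epsilon>))" .
  qed
  show "f * g = g * f"
    by (transfer, rule ext, rule sum.reindex_bij_witness [where i = prod.swap and j = prod.swap])
      (auto simp: add.commute mult.commute)
  show "1 * f = f"
  proof (transfer, rule ext)
    fix f :: "nat ^ 'a \<Rightarrow> complex" and \<alpha>
    have "(\<Sum>(\<beta>, \<gamma>) | \<beta> + \<gamma> = \<alpha>. (if \<beta> = 0 then 1 else 0) * f \<gamma>)
        = (\<Sum>(\<beta>, \<gamma>)\<in>{(0 :: nat ^ 'a, \<alpha>)}. (if \<beta> = 0 then 1 else 0) * f \<gamma>)"
      by (rule sum.mono_neutral_right) (auto split: if_splits)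
    then show "(\<Sum>(\<beta>, \<gamma>) | \<beta> + \<gamma> = \<alpha>. (if \<beta> = 0 then 1 else 0) * f \<gamma>) = f \<alpha>"
      by simp
  qed
  show "(f + g) * h = f * h + g * h"
    by (transfer, rule ext) (simp add: split_def distrib_right sum.distrib)
  show "f + g + h = f + (g + h)" by transfer (simp add: add.assoc)
  show "f + g = g + f" by transfer (simp add: add.commute)
  show "0 + f = f" by transfer simp
  show "- f + f = 0" by transfer simp
  show "f - g = f + - g" by transfer simp
  show "(0 :: 'a mfps) \<noteq> 1" by transfer (auto simp: fun_eq_iff)
qed

end

lift_definition mvar :: "'m::finite \<Rightarrow> 'm mfps" is
  "\<lambda>k \<alpha>. if \<alpha> = axis k 1 then 1 else 0" .

lift_definition mderiv :: "'m::finite \<Rightarrow> 'm mfps \<Rightarrow> 'm mfps" is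
  "\<lambda>k f \<alpha>. of_nat (\<alpha> $ k + 1) * f (\<alpha> + axis k 1)" .

lift_definition homogeneous_part :: "nat \<Rightarrow> 'm::finite mfps \<Rightarrow> 'm mfps" is
  "\<lambda>k f \<alpha>. if mdeg \<alpha> = k then f \<alpha> else 0" .

text \<open>The infimum of the empty set is \<open>\<infinity>\<close>, so that \<open>mord 0 = \<infinity>\<close>.\<close>

definition mord :: "'m::finite mfps \<Rightarrow> enat" where
  "mord f = (INF k\<in>{k. homogeneous_part k f \<noteq> 0}. enat k)"

section \<open>Convergent and Gevrey series\<close>

definition convergent_mfps :: "'m::finite mfps set" where
  "convergent_mfps = {f. eventually (\<lambda>z :: complex ^ 'm.
     (\<lambda>\<alpha>. mcoeff f \<alpha> * (\<Prod>i\<in>UNIV. z $ i ^ \<alpha> $ i)) summable_on UNIV) (nhds 0)}"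

text \<open>The series $\sum_k f_k / (k!)^s$, where $f_k$ is the homogeneous part of degree $k$ of $f$.\<close>

lift_definition gevrey_transform :: "real \<Rightarrow> 'm::finite mfps \<Rightarrow> 'm mfps" is
  "\<lambda>s f \<alpha>. f \<alpha> / complex_of_real (fact (mdeg \<alpha>) powr s)" .

definition gevrey :: "real \<Rightarrow> 'm::finite mfps set" where
  "gevrey s = {f. gevrey_transform s f \<in> convergent_mfps}"

section \<open>Formal vector fields and the exponential\<close>

text \<open>
  The vector field $X = \sum_k X(x_k)\,\partial/\partial x_k$ is represented by the vector of its
  components $X(x_k)$.
\<close>

definition formal_vector_fields :: "nat \<Rightarrow> ('m::finite mfps ^ 'm) set" where
  "formal_vector_fields n = {X. \<forall>k. mord (X $ k) \<ge> enat n}"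

definition vf_apply :: "'m::finite mfps ^ 'm \<Rightarrow> 'm mfps \<Rightarrow> 'm mfps" where
  "vf_apply X g = (\<Sum>k\<in>UNIV. X $ k * mderiv k g)"

text \<open>
  The sum $\sum_j X^j(g)/j!$ is taken coefficientwise.  If $X$ has order $\ge 2$, then $X^j(g)$ has
  order $\ge j$, so only finitely many terms contribute to each coefficient; see
  \<open>vf_apply_funpow_coeff_eq_0\<close> below.
\<close>

definition vf_exp :: "'m::finite mfps ^ 'm \<Rightarrow> 'm mfps \<Rightarrow> 'm mfps" where
  "vf_exp X g = Abs_mfps (\<lambda>\<alpha>. \<Sum>j. mcoeff ((vf_apply X ^^ j) g) \<alpha> / fact j)"

definition Exp :: "'m::finite mfps ^ 'm \<Rightarrow> 'm mfps ^ 'm" where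
  "Exp X = (\<chi> i. vf_exp X (mvar i))"

definition gevrey_vector_fields :: "nat \<Rightarrow> real \<Rightarrow> ('m::finite mfps ^ 'm) set" where
  "gevrey_vector_fields n s = {X \<in> formal_vector_fields n. \<forall>k. X $ k \<in> gevrey s}"

section \<open>Formal diffeomorphisms\<close>

text \<open>A formal diffeomorphism $F$ is represented by the vector of its components $x_i \circ F$.\<close>

definition linear_part :: "'m::finite mfps ^ 'm \<Rightarrow> complex ^ 'm ^ 'm" where
  "linear_part F = (\<chi> i j. mcoeff (F $ i) (axis j 1))"

definition formal_diffeos :: "('m::finite mfps ^ 'm) set" where
  "formal_diffeos = {F. (\<forall>i. mcoeff (F $ i) 0 = 0) \<and> invertible (linear_part F)}"

definition diffeo_order :: "'m::finite mfps ^ 'm \<Rightarrow> enat" where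
  "diffeo_order F = (MIN i. mord (F $ i - mvar i)) - 1"

definition tangent_to_identity :: "'m::finite mfps ^ 'm \<Rightarrow> bool" where
  "tangent_to_identity F \<longleftrightarrow> F \<in> formal_diffeos \<and> diffeo_order F \<ge> 1"

definition formal_diffeos_order :: "nat \<Rightarrow> ('m::finite mfps ^ 'm) set" where
  "formal_diffeos_order n = {F \<in> formal_diffeos. diffeo_order F \<ge> enat n}"

definition gevrey_diffeos :: "nat \<Rightarrow> real \<Rightarrow> ('m::finite mfps ^ 'm) set" where
  "gevrey_diffeos n s = {F \<in> formal_diffeos_order n. \<forall>i. F $ i \<in> gevrey s}"

definition infinitesimal_generator :: "'m::finite mfps ^ 'm \<Rightarrow> 'm mfps ^ 'm" where
  "infinitesimal_generator F = (THE X. X \<in> formal_vector_fields 2 \<and> Exp X = F)"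

definition inverse_order :: "enat \<Rightarrow> real" where
  "inverse_order \<nu> = (case \<nu> of enat p \<Rightarrow> 1 / real p | \<infinity> \<Rightarrow> 0)"

section \<open>Finiteness of the exponential sum\<close>

lemma mord_ge_iff: "enat n \<le> mord f \<longleftrightarrow> (\<forall>\<alpha>. mdeg \<alpha> < n \<longrightarrow> mcoeff f \<alpha> = 0)"
proof -
  have *: "homogeneous_part k f = 0 \<longleftrightarrow> (\<forall>\<alpha>. mdeg \<alpha> = k \<longrightarrow> mcoeff f \<alpha> = 0)" for k
    by transfer (auto simp: fun_eq_iff)
  have "enat n \<le> mord f \<longleftrightarrow> (\<forall>k<n. homogeneous_part k f = 0)"
    unfolding mord_def le_INF_iff by (auto simp: not_le [symmetric])
  then show ?thesis by (auto simp: *)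
qed

lemma mcoeff_sum: "mcoeff (sum f A) \<alpha> = (\<Sum>i\<in>A. mcoeff (f i) \<alpha>)"
  by (induction A rule: infinite_finite_induct) (simp_all add: zero_mfps.rep_eq plus_mfps.rep_eq)

lemma vf_apply_funpow_coeff_eq_0:
  assumes "X \<in> formal_vector_fields 2" and "mdeg \<alpha> < j"
  shows "mcoeff ((vf_apply X ^^ j) g) \<alpha> = 0"
  using assms(2)
proof (induction j arbitrary: \<alpha>)
  case (Suc j)
  have "mcoeff (X $ k) \<beta> * mcoeff (mderiv k ((vf_apply X ^^ j) g)) \<gamma> = 0"
    if "\<beta> + \<gamma> = \<alpha>" for k \<beta> \<gamma>
  proof (cases "mdeg \<beta> < 2")
    case True
    then show ?thesis using assms(1) by (auto simp: formal_vector_fields_def mord_ge_iff)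
  next
    case False
    have "mdeg \<beta> + mdeg \<gamma> < Suc j" using Suc.prems that by (metis mdeg_add)
    with False have "mdeg (\<gamma> + axis k 1) < j" by simp
    then show ?thesis using Suc.IH by (simp add: mderiv.rep_eq)
  qed
  then show ?case
    unfolding funpow.simps comp_def vf_apply_def [of X "(vf_apply X ^^ j) g"]
    by (simp only: mcoeff_sum times_mfps.rep_eq) (auto intro!: sum.neutral simp del: mult_eq_0_iff)
qed simp

end

theory Submission
  imports Defs
begin

text \<open>
  In $F = \mathrm{Exp}(X)$, the degree-$d$ part of the tail $\sum_{j \ge 2} X^j(x_i)/j!$ depends
  only on the part of $X$ of degree less than $d$.  Hence $X$ is the unique solution of a triangular
  fixed-point equation, which gives the formal bijection.  The same triangularity gives the Gevrey
  estimates in both directions: measure homogeneous parts by the sum of the absolute values of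
  their coefficients, and let $p = n - 1$ and $W_r = (r!)^s / (r + 1)^2$.  Since $s \ge 1/p$,
  $$\sum_{p \le q \le r - p} W_q W_{r-q} (r - q + 1) \le 16\, p\, W_r.$$
  So if the degree-$(r+1)$ parts of $X$ are bounded by $c A^r W_r$ for a suitable small $c$
  independent of $A$, every further application of $X$ gains a factor $1/4$, and the tail is at
  most half of the bound on $X$.  The parameter $A$ remains free to dominate the given Gevrey data.
\<close>

section \<open>Coefficients and degrees of multi-indices\<close>

lemmas mcoeff_simps [simp] = zero_mfps.rep_eq plus_mfps.rep_eq minus_mfps.rep_eq uminus_mfps.rep_eq
  mderiv.rep_eq mvar.rep_eq

lemma mcoeff_Abs_mfps [simp]: "mcoeff (Abs_mfps c) = c"
  by (simp add: Abs_mfps_inverse)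

lemma finite_mdeg_eq [simp]: "finite {\<alpha> :: nat ^ 'm::finite. mdeg \<alpha> = d}"
proof (rule finite_subset)
  let ?B = "vec_lambda ` (Pi\<^sub>E UNIV (\<lambda>_. {..d})) :: (nat ^ 'm) set"
  show "{\<alpha> :: nat ^ 'm. mdeg \<alpha> = d} \<subseteq> ?B"
  proof
    fix \<alpha> :: "nat ^ 'm" assume "\<alpha> \<in> {\<alpha>. mdeg \<alpha> = d}"
    then have "\<alpha> $ i \<le> d" for i
      using member_le_sum[of i UNIV "vec_nth \<alpha>"] by (auto simp: mdeg_def)
    then show "\<alpha> \<in> ?B"
      by (intro image_eqI[where x = "vec_nth \<alpha>"]) auto
  qed
  show "finite ?B"
    by (intro finite_imageI finite_PiE) auto
qed

lemma mdeg_eq_0_iff: "mdeg \<alpha> = 0 \<longleftrightarrow> \<alpha> = 0"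
  by (auto simp: mdeg_def vec_eq_iff)

section \<open>The degreewise \<open>\<ell>\<^sup>1\<close>-norm\<close>

text \<open>Summing absolute values, instead of taking their maximum, makes products
  submultiplicative across degrees with constant 1, so no count of multi-indices enters the
  estimates.\<close>

definition hnorm :: "nat \<Rightarrow> 'm::finite mfps \<Rightarrow> real" where
  "hnorm d f = (\<Sum>\<alpha> | mdeg \<alpha> = d. norm (mcoeff f \<alpha>))"

lemma hnorm_nonneg [simp]: "hnorm d f \<ge> 0"
  by (simp add: hnorm_def sum_nonneg)

lemma hnorm_add: "hnorm d (f + g) \<le> hnorm d f + hnorm d g"
  unfolding hnorm_def sum.distrib [symmetric] by (intro sum_mono) (simp add: norm_triangle_ineq)

lemma hnorm_diff: "hnorm d (f - g) \<le> hnorm d f + hnorm d g"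
  unfolding hnorm_def sum.distrib [symmetric] by (intro sum_mono) (simp add: norm_triangle_ineq4)

lemma hnorm_0 [simp]: "hnorm d 0 = 0"
  by (simp add: hnorm_def)

lemma hnorm_sum: "hnorm d (sum f A) \<le> (\<Sum>i\<in>A. hnorm d (f i))"
  by (induction A rule: infinite_finite_induct) (auto intro: order_trans[OF hnorm_add])

lemma hnorm_eq_0: "enat n \<le> mord f \<Longrightarrow> d < n \<Longrightarrow> hnorm d f = 0"
  by (simp add: hnorm_def mord_ge_iff)

lemma hnorm_mult: "hnorm d (f * g) \<le> (\<Sum>a\<le>d. hnorm a f * hnorm (d - a) g)"
proof -
  let ?H = "\<lambda>d. {\<alpha> :: nat ^ 'a. mdeg \<alpha> = d}"
  let ?S = "\<lambda>\<alpha> :: nat ^ 'a. {(\<beta>, \<gamma>). \<beta> + \<gamma> = \<alpha>}"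
  let ?t = "\<lambda>(\<beta>, \<gamma>). norm (mcoeff f \<beta>) * norm (mcoeff g \<gamma>)"
  have "hnorm d (f * g) \<le> (\<Sum>\<alpha>\<in>?H d. \<Sum>x\<in>?S \<alpha>. ?t x)"
    unfolding hnorm_def times_mfps.rep_eq
    by (intro sum_mono order_trans[OF norm_sum]) (auto simp: norm_mult case_prod_unfold)
  also have "\<dots> = (\<Sum>(\<alpha>, x)\<in>Sigma (?H d) ?S. ?t x)"
    using finite_sum_eq by (subst sum.Sigma) auto
  \<comment> \<open>A pair \<open>(\<beta>, \<gamma>)\<close> determines its sum, so the pairs of
    total degree \<open>d\<close> can be regrouped by the degree of \<beta>.\<close>
  also have "\<dots> = (\<Sum>(a, x)\<in>Sigma {..d} (\<lambda>a. ?H a \<times> ?H (d - a)). ?t x)"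
    by (rule sum.reindex_bij_witness[where
          i = "\<lambda>(a, (\<beta>, \<gamma>)). (\<beta> + \<gamma>, (\<beta>, \<gamma>))" and j = "\<lambda>(\<alpha>, (\<beta>, \<gamma>)). (mdeg \<beta>, (\<beta>, \<gamma>))"]) auto
  also have "\<dots> = (\<Sum>a\<le>d. \<Sum>x\<in>?H a \<times> ?H (d - a). ?t x)"
    by (subst sum.Sigma) auto
  also have "\<dots> = (\<Sum>a\<le>d. hnorm a f * hnorm (d - a) g)"
    by (simp add: hnorm_def sum_product sum.cartesian_product)
  finally show ?thesis .
qed

text \<open>The exponent brought down is at most \<open>d + 1\<close>, and raising the exponent of
  one variable is injective on monomials, so no coefficient is counted twice.\<close>

lemma hnorm_mderiv: "hnorm d (mderiv k f) \<le> real (Suc d) * hnorm (Suc d) f"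
proof -
  have "hnorm d (mderiv k f)
      \<le> (\<Sum>\<alpha> | mdeg \<alpha> = d. real (Suc d) * norm (mcoeff f (\<alpha> + axis k 1)))"
    unfolding hnorm_def
  proof (intro sum_mono)
    fix \<alpha> :: "nat ^ 'a" assume "\<alpha> \<in> {\<alpha>. mdeg \<alpha> = d}"
    then have "\<alpha> $ k \<le> d"
      using member_le_sum[of k UNIV "vec_nth \<alpha>"] by (auto simp: mdeg_def)
    then have "norm (of_nat (\<alpha> $ k + 1) :: complex) \<le> real (Suc d)"
      unfolding norm_of_nat by simp
    then show "norm (mcoeff (mderiv k f) \<alpha>) \<le> real (Suc d) * norm (mcoeff f (\<alpha> + axis k 1))"
      unfolding mderiv.rep_eq norm_mult by (intro mult_right_mono) auto
  qed
  also have "\<dots> = real (Suc d) *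
      (\<Sum>\<alpha>\<in>(\<lambda>\<alpha>. \<alpha> + axis k 1) ` {\<alpha>. mdeg \<alpha> = d}. norm (mcoeff f \<alpha>))"
    by (subst sum.reindex) (auto simp: sum_distrib_left inj_on_def)
  also have "\<dots> \<le> real (Suc d) * hnorm (Suc d) f"
    unfolding hnorm_def by (intro mult_left_mono sum_mono2) auto
  finally show ?thesis .
qed

text \<open>Indices are degrees minus one, so that \<open>q\<close> and \<open>r - q\<close> add up
  to \<open>r\<close>. The bound \<open>\<xi> q\<close> is demanded only where both factors are
  nonzero: the orders of \<open>X\<close> and \<open>g\<close> can then discard the indices at which
  no estimate is known yet.\<close>

lemma hnorm_vf_apply:
  assumes "\<And>k. hnorm 0 (X $ k) = 0"
    and "\<And>k q. q \<le> r \<Longrightarrow> hnorm (Suc q) (X $ k) \<noteq> 0 \<Longrightarrow> hnorm (Suc (r - q)) g \<noteq> 0 \<Longrightarrow>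
      hnorm (Suc q) (X $ k) \<le> \<xi> q"
    and "\<And>q. \<xi> q \<ge> 0"
  shows "hnorm (Suc r) (vf_apply (X :: 'm::finite mfps ^ 'm) g)
    \<le> real CARD('m) * (\<Sum>q\<le>r. \<xi> q * (real (Suc (r - q)) * hnorm (Suc (r - q)) g))"
proof -
  have "hnorm (Suc r) (X $ k * mderiv k g)
    \<le> (\<Sum>q\<le>r. \<xi> q * (real (Suc (r - q)) * hnorm (Suc (r - q)) g))" for k
  proof -
    have "hnorm (Suc r) (X $ k * mderiv k g)
      \<le> (\<Sum>a\<le>Suc r. hnorm a (X $ k) * hnorm (Suc r - a) (mderiv k g))"
      by (rule hnorm_mult)
    also have "\<dots> = (\<Sum>q\<le>r. hnorm (Suc q) (X $ k) * hnorm (r - q) (mderiv k g))"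
      by (subst sum.atMost_Suc_shift) (simp add: assms(1))
    also have "\<dots> \<le> (\<Sum>q\<le>r. \<xi> q * (real (Suc (r - q)) * hnorm (Suc (r - q)) g))"
    proof (intro sum_mono)
      fix q assume q: "q \<in> {..r}"
      have "hnorm (Suc q) (X $ k) * hnorm (r - q) (mderiv k g)
          \<le> hnorm (Suc q) (X $ k) * (real (Suc (r - q)) * hnorm (Suc (r - q)) g)"
        by (intro mult_left_mono hnorm_mderiv) auto
      also have "\<dots> \<le> \<xi> q * (real (Suc (r - q)) * hnorm (Suc (r - q)) g)"
      proof (cases "hnorm (Suc q) (X $ k) = 0 \<or> hnorm (Suc (r - q)) g = 0")
        case True
        then show ?thesis using assms(3)[of q] by auto
      next
        case False
        then show ?thesis using assms(2)[of q k] q by (intro mult_right_mono) auto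
      qed
      finally show "hnorm (Suc q) (X $ k) * hnorm (r - q) (mderiv k g)
        \<le> \<xi> q * (real (Suc (r - q)) * hnorm (Suc (r - q)) g)" .
    qed
    finally show ?thesis .
  qed
  then have "(\<Sum>k\<in>UNIV. hnorm (Suc r) (X $ k * mderiv k g)) \<le>
      (\<Sum>k\<in>(UNIV :: 'm set). \<Sum>q\<le>r. \<xi> q * (real (Suc (r - q)) * hnorm (Suc (r - q)) g))"
    by (intro sum_mono)
  then show ?thesis
    unfolding vf_apply_def using hnorm_sum[of "Suc r" "\<lambda>k. X $ k * mderiv k g" UNIV] by simp
qed

section \<open>Gevrey series through the degreewise norm\<close>

lemma monomial_const:
  "(\<Prod>i\<in>UNIV. c ^ (\<alpha> :: nat ^ 'm::finite) $ i) = (c :: 'a :: comm_monoid_mult) ^ mdeg \<alpha>"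
  by (simp add: mdeg_def power_sum)

text \<open>One direction evaluates the series at a point with equal coordinates and uses absolute
  convergence there; the other compares with a geometric series on a small ball.\<close>

lemma convergent_mfps_iff:
  "f \<in> convergent_mfps \<longleftrightarrow> (\<exists>C B. B > 0 \<and> (\<forall>d. hnorm d f \<le> C * B ^ d))"
proof
  assume "f \<in> convergent_mfps"
  then obtain e where e: "e > 0" and sm: "\<And>z :: complex ^ 'a. dist z 0 < e \<Longrightarrow>
      (\<lambda>\<alpha>. mcoeff f \<alpha> * (\<Prod>i\<in>UNIV. z $ i ^ \<alpha> $ i)) summable_on UNIV"
    unfolding convergent_mfps_def eventually_nhds_metric by auto
  \<comment> \<open>With this choice the vector whose coordinates all equal \<rho> has norm at most
    \<open>e / 2\<close>.\<close>
  define \<rho> where "\<rho> = e / (2 * real CARD('a))"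
  have \<rho>: "\<rho> > 0" using e by (simp add: \<rho>_def)
  let ?z = "\<chi> i. complex_of_real \<rho> :: complex ^ 'a"
  have "norm ?z \<le> (\<Sum>i\<in>UNIV. norm (?z $ i))" unfolding norm_vec_def by (rule L2_set_le_sum) simp
  also have "\<dots> = e / 2" using e by (simp add: \<rho>_def norm_divide)
  also have "\<dots> < e" using e by simp
  finally have "(\<lambda>\<alpha>. mcoeff f \<alpha> * (\<Prod>i\<in>UNIV. ?z $ i ^ \<alpha> $ i)) summable_on UNIV"
    by (intro sm) simp
  then have "(\<lambda>\<alpha>. mcoeff f \<alpha> * of_real \<rho> ^ mdeg \<alpha>) summable_on UNIV"
    by (simp add: monomial_const)
  \<comment> \<open>Unordered summability of complex families is absolute.\<close>
  then have "(\<lambda>\<alpha>. norm (mcoeff f \<alpha> * of_real \<rho> ^ mdeg \<alpha>)) summable_on UNIV"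
    by (simp add: summable_on_iff_abs_summable_on_complex)
  then have sum: "(\<lambda>\<alpha>. norm (mcoeff f \<alpha>) * \<rho> ^ mdeg \<alpha>) summable_on UNIV"
    using \<rho> by (simp add: norm_mult norm_power)
  define C where "C = (\<Sum>\<^sub>\<infinity>\<alpha>. norm (mcoeff f \<alpha>) * \<rho> ^ mdeg \<alpha>)"
  have "hnorm d f * \<rho> ^ d \<le> C" for d
  proof -
    have "hnorm d f * \<rho> ^ d = (\<Sum>\<alpha> | mdeg \<alpha> = d. norm (mcoeff f \<alpha>) * \<rho> ^ mdeg \<alpha>)"
      by (simp add: hnorm_def sum_distrib_right)
    also have "\<dots> \<le> C"
      unfolding C_def using sum \<rho> by (intro finite_sum_le_infsum) auto
    finally show ?thesis .
  qed
  then have "\<forall>d. hnorm d f \<le> C * (1 / \<rho>) ^ d"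
    using \<rho> by (simp add: field_simps)
  with \<rho> show "\<exists>C B. B > 0 \<and> (\<forall>d. hnorm d f \<le> C * B ^ d)"
    by (intro exI[of _ C] exI[of _ "1 / \<rho>"]) auto
next
  assume "\<exists>C B. B > 0 \<and> (\<forall>d. hnorm d f \<le> C * B ^ d)"
  then obtain C B where B: "B > 0" and bd: "\<And>d. hnorm d f \<le> C * B ^ d" by blast
  have C: "C \<ge> 0" using order_trans[OF hnorm_nonneg bd[of 0]] by simp
  \<comment> \<open>Degree \<open>d\<close> then contributes at most \<open>C * (1 / 2) ^ d\<close>,
    so all finite partial sums stay below \<open>2 * C\<close>.\<close>
  define \<rho> where "\<rho> = 1 / (2 * B)"
  have \<rho>: "\<rho> > 0" "B * \<rho> = 1 / 2" using B by (simp_all add: \<rho>_def)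
  have sum: "(\<lambda>\<alpha>. norm (mcoeff f \<alpha>) * \<rho> ^ mdeg \<alpha>) summable_on UNIV"
  proof (rule nonneg_bdd_above_summable_on)
    have "(\<Sum>\<alpha>\<in>S. norm (mcoeff f \<alpha>) * \<rho> ^ mdeg \<alpha>) \<le> 2 * C" if S: "finite S" for S
    proof -
      define D where "D = Max (insert 0 (mdeg ` S))"
      have D: "mdeg \<alpha> \<le> D" if "\<alpha> \<in> S" for \<alpha> using S that by (simp add: D_def)
      have "(\<Sum>\<alpha>\<in>S. norm (mcoeff f \<alpha>) * \<rho> ^ mdeg \<alpha>)
          \<le> (\<Sum>\<alpha>\<in>(\<Union>d\<le>D. {\<alpha>. mdeg \<alpha> = d}). norm (mcoeff f \<alpha>) * \<rho> ^ mdeg \<alpha>)"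
        using \<rho> D by (intro sum_mono2) auto
      also have "\<dots> = (\<Sum>d\<le>D. \<Sum>\<alpha> | mdeg \<alpha> = d. norm (mcoeff f \<alpha>) * \<rho> ^ mdeg \<alpha>)"
        by (rule sum.UNION_disjoint) auto
      also have "\<dots> = (\<Sum>d\<le>D. hnorm d f * \<rho> ^ d)"
        by (simp add: hnorm_def sum_distrib_right)
      also have "\<dots> \<le> (\<Sum>d\<le>D. C * (1 / 2) ^ d)"
      proof (intro sum_mono)
        fix d
        have "hnorm d f * \<rho> ^ d \<le> C * B ^ d * \<rho> ^ d"
          using \<rho> bd by (intro mult_right_mono) auto
        also have "\<dots> = C * (1 / 2) ^ d" by (simp add: \<rho>(2) [symmetric] power_mult_distrib)
        finally show "hnorm d f * \<rho> ^ d \<le> C * (1 / 2) ^ d" .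
      qed
      also have "\<dots> = C * (\<Sum>d\<le>D. (1 / 2) ^ d)" by (simp add: sum_distrib_left)
      also have "\<dots> \<le> C * 2"
      proof (intro mult_left_mono C)
        show "(\<Sum>d\<le>D. (1 / 2 :: real) ^ d) \<le> 2"
          unfolding lessThan_Suc_atMost [symmetric] by (subst geometric_sum) (auto simp: field_simps)
      qed
      finally show ?thesis by simp
    qed
    then show "bdd_above (sum (\<lambda>\<alpha>. norm (mcoeff f \<alpha>) * \<rho> ^ mdeg \<alpha>) ` {F. F \<subseteq> UNIV \<and> finite F})"
      by (auto intro!: bdd_aboveI[of _ "2 * C"])
  qed (use \<rho> in auto)
  have "(\<lambda>\<alpha>. mcoeff f \<alpha> * (\<Prod>i\<in>UNIV. z $ i ^ \<alpha> $ i)) summable_on UNIV"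
    if "dist z 0 < \<rho>" for z :: "complex ^ 'a"
  proof (rule abs_summable_summable, rule summable_on_comparison_test[OF sum])
    fix \<alpha> :: "nat ^ 'a"
    have z: "norm (z $ i) \<le> \<rho>" for i
      using that Finite_Cartesian_Product.norm_nth_le[of z i] by simp
    have "(\<Prod>i\<in>UNIV. norm (z $ i) ^ \<alpha> $ i) \<le> (\<Prod>i\<in>UNIV. \<rho> ^ \<alpha> $ i)"
      using z by (intro prod_mono) (auto intro: power_mono)
    then show "norm (mcoeff f \<alpha> * (\<Prod>i\<in>UNIV. z $ i ^ \<alpha> $ i)) \<le> norm (mcoeff f \<alpha>) * \<rho> ^ mdeg \<alpha>"
      unfolding norm_mult monomial_const [symmetric] prod_norm [symmetric] norm_power
      by (intro mult_left_mono) auto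
  qed auto
  then show "f \<in> convergent_mfps"
    unfolding convergent_mfps_def eventually_nhds_metric using \<rho>(1) by auto
qed

lemma hnorm_gevrey_transform: "hnorm d (gevrey_transform s f) = hnorm d f / fact d powr s"
  by (simp add: hnorm_def gevrey_transform.rep_eq sum_divide_distrib norm_divide)

lemma gevrey_iff:
  "f \<in> gevrey s \<longleftrightarrow> (\<exists>C B. B > 0 \<and> (\<forall>d. hnorm d f \<le> C * B ^ d * fact d powr s))"
  by (simp add: gevrey_def convergent_mfps_iff hnorm_gevrey_transform divide_le_eq)

lemma convergent_imp_gevrey:
  assumes "f \<in> convergent_mfps" "s \<ge> 0"
  shows "f \<in> gevrey s"
proof -
  from assms(1) obtain C B where B: "B > 0" and bd: "\<And>d. hnorm d f \<le> C * B ^ d"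
    unfolding convergent_mfps_iff by blast
  have C: "C \<ge> 0" using order_trans[OF hnorm_nonneg bd[of 0]] by simp
  have "hnorm d f \<le> C * B ^ d * fact d powr s" for d
  proof -
    have "1 \<le> fact d powr s" using assms(2) by (intro ge_one_powr_ge_zero) auto
    then have "C * B ^ d * 1 \<le> C * B ^ d * fact d powr s"
      using B C by (intro mult_left_mono) auto
    with bd[of d] show ?thesis by simp
  qed
  with B show ?thesis unfolding gevrey_iff by blast
qed

section \<open>Formal bijectivity\<close>

lemma formal_vector_fields_antimono: "m \<le> n \<Longrightarrow> formal_vector_fields n \<subseteq> formal_vector_fields m"
  by (auto simp: formal_vector_fields_def mord_ge_iff)

lemma mcoeff_vf_apply:
  "mcoeff (vf_apply X g) \<alpha> =
    (\<Sum>k\<in>UNIV. \<Sum>(\<beta>, \<gamma>) | \<beta> + \<gamma> = \<alpha>. mcoeff (X $ k) \<beta> * mcoeff (mderiv k g) \<gamma>)"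
  by (simp add: vf_apply_def mcoeff_sum times_mfps.rep_eq)

lemma mord_vf_apply_ge:
  assumes "X \<in> formal_vector_fields n"
  shows "enat n \<le> mord (vf_apply X g)"
  unfolding mord_ge_iff mcoeff_vf_apply
proof (intro allI impI sum.neutral ballI, clarify)
  fix k and \<beta> \<gamma> :: "nat ^ 'a" assume "mdeg (\<beta> + \<gamma>) < n"
  then show "mcoeff (X $ k) \<beta> * mcoeff (mderiv k g) \<gamma> = 0"
    using assms by (simp add: formal_vector_fields_def mord_ge_iff)
qed

lemma vf_apply_mvar [simp]: "vf_apply X (mvar i) = X $ i"
proof -
  have "mderiv k (mvar i) = (if k = i then 1 else 0)" for k :: 'a
  proof (rule mfps_eqI)
    fix \<alpha> :: "nat ^ 'a"
    have "\<alpha> + axis k 1 = axis i 1 \<longleftrightarrow> \<alpha> = 0 \<and> k = i"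
    proof
      assume *: "\<alpha> + axis k 1 = axis i 1"
      then have "mdeg \<alpha> + 1 = 1" by (metis mdeg_add mdeg_axis)
      then show "\<alpha> = 0 \<and> k = i" using * by (auto simp: mdeg_eq_0_iff axis_eq_axis)
    qed auto
    then show "mcoeff (mderiv k (mvar i)) \<alpha> = mcoeff (if k = i then 1 else 0) \<alpha>"
      by (auto simp: one_mfps.rep_eq)
  qed
  then have "X $ k * mderiv k (mvar i) = (if k = i then X $ k else 0)" for k
    by simp
  then show ?thesis by (simp add: vf_apply_def)
qed

text \<open>The part of the exponential from the second power on. For \<open>X\<close> of order at
  least 2 the powers \<open>j > mdeg \<alpha>\<close> do not reach the coefficient at \<alpha>, so
  the finite range loses nothing.\<close>

definition exp_tail :: "'m::finite mfps ^ 'm \<Rightarrow> 'm \<Rightarrow> 'm mfps" where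
  "exp_tail X i = Abs_mfps (\<lambda>\<alpha>. \<Sum>j\<in>{2..mdeg \<alpha>}. mcoeff ((vf_apply X ^^ j) (mvar i)) \<alpha> / fact j)"

lemma Exp_eq:
  assumes X: "X \<in> formal_vector_fields 2"
  shows "Exp X $ i = mvar i + X $ i + exp_tail X i"
proof (rule mfps_eqI)
  fix \<alpha> :: "nat ^ 'a"
  let ?c = "\<lambda>j. mcoeff ((vf_apply X ^^ j) (mvar i)) \<alpha> / fact j"
  have "mcoeff (Exp X $ i) \<alpha> = (\<Sum>j. ?c j)"
    by (simp add: Exp_def vf_exp_def)
  \<comment> \<open>Adjoining \<open>{0, 1}\<close> keeps the terms \<open>mvar i\<close> and
    \<open>X $ i\<close> explicit even when \<alpha> has degree 0.\<close>
  also have "\<dots> = (\<Sum>j\<in>{..mdeg \<alpha>} \<union> {0, 1}. ?c j)"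
    by (rule suminf_finite) (auto simp: vf_apply_funpow_coeff_eq_0[OF X])
  also have "{..mdeg \<alpha>} \<union> {0, 1} = {0, 1} \<union> {2..mdeg \<alpha>}" by auto
  also have "(\<Sum>j\<in>\<dots>. ?c j) = (\<Sum>j\<in>{0, 1}. ?c j) + (\<Sum>j\<in>{2..mdeg \<alpha>}. ?c j)"
    by (rule sum.union_disjoint) auto
  also have "\<dots> = mcoeff (mvar i + X $ i + exp_tail X i) \<alpha>"
    by (simp add: exp_tail_def)
  finally show "mcoeff (Exp X $ i) \<alpha> = mcoeff (mvar i + X $ i + exp_tail X i) \<alpha>" .
qed

text \<open>Each summand is \<open>X\<close> applied to some series, so the order of
  \<open>X\<close> alone bounds its order.\<close>

lemma mord_exp_tail_ge:
  assumes X: "X \<in> formal_vector_fields n"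
  shows "enat n \<le> mord (exp_tail X i)"
  unfolding mord_ge_iff
proof (intro allI impI)
  fix \<alpha> :: "nat ^ 'a" assume "mdeg \<alpha> < n"
  then have "mcoeff ((vf_apply X ^^ j) (mvar i)) \<alpha> = 0" if "j \<in> {2..mdeg \<alpha>}" for j
    using that mord_vf_apply_ge[OF X, unfolded mord_ge_iff] by (cases j) auto
  then show "mcoeff (exp_tail X i) \<alpha> = 0"
    by (simp add: exp_tail_def)
qed

text \<open>Congruence modulo the \<open>d\<close>-th power of the maximal ideal.\<close>

definition agree :: "nat \<Rightarrow> 'm::finite mfps \<Rightarrow> 'm mfps \<Rightarrow> bool" where
  "agree d f g \<longleftrightarrow> (\<forall>\<alpha>. mdeg \<alpha> < d \<longrightarrow> mcoeff f \<alpha> = mcoeff g \<alpha>)"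

text \<open>One degree is gained: in a nonzero product \<beta> has degree at least 2 and \<gamma> at
  least 1, so with total degree at most \<open>d\<close> both \<beta> and
  \<open>\<gamma> + axis k 1\<close> have degree below \<open>d\<close>.\<close>

lemma agree_vf_apply:
  assumes X: "X \<in> formal_vector_fields 2" "Y \<in> formal_vector_fields 2" "\<And>k. agree d (X $ k) (Y $ k)"
    and g: "enat 2 \<le> mord g" "enat 2 \<le> mord h" "agree d g h"
  shows "agree (Suc d) (vf_apply X g) (vf_apply Y h)"
  unfolding agree_def mcoeff_vf_apply
proof (intro allI impI sum.cong refl, clarify)
  fix k and \<beta> \<gamma> :: "nat ^ 'a" assume d: "mdeg (\<beta> + \<gamma>) < Suc d"
  have 0: "mcoeff (X $ k) \<beta> = 0 \<and> mcoeff (Y $ k) \<beta> = 0" if "mdeg \<beta> < 2"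
    using X that by (simp add: formal_vector_fields_def mord_ge_iff)
  have 1: "mcoeff g (\<gamma> + axis k 1) = 0 \<and> mcoeff h (\<gamma> + axis k 1) = 0" if "mdeg \<gamma> < 1"
    using g that by (simp add: mord_ge_iff)
  consider "mdeg \<beta> < 2" | "mdeg \<gamma> < 1" | "mdeg \<beta> < d" "mdeg \<gamma> + 1 < d"
    using d unfolding mdeg_add by linarith
  then show "mcoeff (X $ k) \<beta> * mcoeff (mderiv k g) \<gamma> = mcoeff (Y $ k) \<beta> * mcoeff (mderiv k h) \<gamma>"
  proof cases
    case 3
    then show ?thesis using X(3)[of k] g(3) by (simp add: agree_def)
  qed (use 0 1 in auto)
qed

lemma agree_exp_tail:
  assumes X: "X \<in> formal_vector_fields 2" "Y \<in> formal_vector_fields 2" "\<And>k. agree d (X $ k) (Y $ k)"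
  shows "agree (Suc d) (exp_tail X i) (exp_tail Y i)"
proof -
  \<comment> \<open>The index is shifted, starting at the first power: there \<open>X $ i\<close>
    agrees only below \<open>d\<close>, and the extra degree comes with every later power. The tail
    contains only later powers.\<close>
  have *: "agree d ((vf_apply X ^^ Suc j) (mvar i)) ((vf_apply Y ^^ Suc j) (mvar i))
      \<and> (j \<ge> 1 \<longrightarrow> agree (Suc d) ((vf_apply X ^^ Suc j) (mvar i)) ((vf_apply Y ^^ Suc j) (mvar i)))" for j
  proof (induction j)
    case 0
    show ?case using X(3) by simp
  next
    case (Suc j)
    have "enat 2 \<le> mord ((vf_apply X ^^ Suc j) (mvar i))" "enat 2 \<le> mord ((vf_apply Y ^^ Suc j) (mvar i))"
      using X mord_vf_apply_ge by auto
    then have "agree (Suc d) (vf_apply X ((vf_apply X ^^ Suc j) (mvar i)))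
        (vf_apply Y ((vf_apply Y ^^ Suc j) (mvar i)))"
      using Suc by (intro agree_vf_apply X) auto
    then show ?case by (auto simp: agree_def)
  qed
  show ?thesis
    unfolding agree_def exp_tail_def mcoeff_Abs_mfps
  proof (intro allI impI sum.cong refl)
    fix \<alpha> :: "nat ^ 'a" and j assume d: "mdeg \<alpha> < Suc d" and j: "j \<in> {2..mdeg \<alpha>}"
    then have "mcoeff ((vf_apply X ^^ j) (mvar i)) \<alpha> = mcoeff ((vf_apply Y ^^ j) (mvar i)) \<alpha>"
      using *[of "j - 1"] by (cases j) (auto simp: agree_def)
    then show "mcoeff ((vf_apply X ^^ j) (mvar i)) \<alpha> / fact j
      = mcoeff ((vf_apply Y ^^ j) (mvar i)) \<alpha> / fact j" by simp
  qed
qed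

text \<open>If the exponentials coincide, \<open>X - Y\<close> is a difference of tails. Agreement
  of the fields below degree \<open>d\<close> thus improves to \<open>d + 1\<close>, and induction
  exhausts all degrees.\<close>

lemma inj_on_Exp: "inj_on Exp (formal_vector_fields 2)"
proof (rule inj_onI)
  fix X Y :: "'a mfps ^ 'a"
  assume X: "X \<in> formal_vector_fields 2" "Y \<in> formal_vector_fields 2" and E: "Exp X = Exp Y"
  have "\<forall>k. agree d (X $ k) (Y $ k)" for d
  proof (induction d)
    case (Suc d)
    have t: "agree (Suc d) (exp_tail X k) (exp_tail Y k)" for k
      using Suc X by (intro agree_exp_tail) auto
    have "X $ k - Y $ k = exp_tail Y k - exp_tail X k" for k
      using Exp_eq[OF X(1), of k] Exp_eq[OF X(2), of k] E by (simp add: algebra_simps)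
    then have "mcoeff (X $ k) \<alpha> - mcoeff (Y $ k) \<alpha> = mcoeff (exp_tail Y k) \<alpha> - mcoeff (exp_tail X k) \<alpha>"
      for k \<alpha> by (metis minus_mfps.rep_eq)
    with t have "mcoeff (X $ k) \<alpha> - mcoeff (Y $ k) \<alpha> = 0" if "mdeg \<alpha> < Suc d" for k \<alpha>
      using that by (simp add: agree_def)
    then show ?case by (simp add: agree_def)
  qed (simp add: agree_def)
  then have "mcoeff (X $ k) \<alpha> = mcoeff (Y $ k) \<alpha>" for k \<alpha>
    by (auto simp: agree_def)
  then show "X = Y" by (simp add: vec_eq_iff mfps_eqI)
qed

text \<open>Being the identity up to order at least 2 forces the linear part to be the identity
  matrix, so invertibility is automatic.\<close>

lemma formal_diffeos_order_iff:
  assumes "n \<ge> 2"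
  shows "F \<in> formal_diffeos_order (n - 1) \<longleftrightarrow> (\<forall>i. enat n \<le> mord (F $ i - mvar i))"
proof -
  \<comment> \<open>Subtraction of 1 truncates at 0; \<open>n \<ge> 2\<close> keeps the left side
    positive, so truncation does no harm.\<close>
  have sub: "enat (n - 1) \<le> e - 1 \<longleftrightarrow> enat n \<le> e" for e
    using assms by (cases e) (auto simp: one_enat_def)
  have ord: "enat (n - 1) \<le> diffeo_order F \<longleftrightarrow> (\<forall>i. enat n \<le> mord (F $ i - mvar i))"
    unfolding diffeo_order_def sub by (subst Min_ge_iff) auto
  have "F \<in> formal_diffeos" if "\<forall>i. enat n \<le> mord (F $ i - mvar i)"
  proof -
    have *: "mcoeff (F $ i) \<alpha> = mcoeff (mvar i) \<alpha>" if "mdeg \<alpha> < 2" for i \<alpha>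
      using \<open>\<forall>i. enat n \<le> _\<close> that assms by (auto simp: mord_ge_iff)
    have "linear_part F = mat 1"
      unfolding linear_part_def mat_def by (simp add: vec_eq_iff * axis_eq_axis [unfolded vec_eq_iff])
    moreover have "mcoeff (F $ i) 0 = 0" for i
      by (simp add: * axis_eq_0_iff)
    ultimately show ?thesis
      by (auto simp: formal_diffeos_def invertible_def intro!: exI[of _ "mat 1"])
  qed
  with ord show ?thesis by (auto simp: formal_diffeos_order_def)
qed

lemma Exp_in_formal_diffeos_order:
  assumes "n \<ge> 2" "X \<in> formal_vector_fields n"
  shows "Exp X \<in> formal_diffeos_order (n - 1)"
proof -
  have X2: "X \<in> formal_vector_fields 2" using formal_vector_fields_antimono assms by blast
  have "enat n \<le> mord (X $ i)" for i using assms by (simp add: formal_vector_fields_def)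
  then show ?thesis
    using mord_exp_tail_ge[OF assms(2)]
    unfolding formal_diffeos_order_iff[OF assms(1)] Exp_eq[OF X2] by (simp add: mord_ge_iff)
qed

text \<open>Solving for the linear term turns the equation into a fixed-point problem for
  \<open>T\<close>, which contracts for \<open>agree\<close>; the solution is the coefficientwise
  limit of the iterates from 0.\<close>

lemma Exp_surj:
  assumes n: "n \<ge> 2" and F: "F \<in> formal_diffeos_order (n - 1)"
  shows "\<exists>X \<in> formal_vector_fields n. Exp X = F"
proof -
  define T where "T X = (\<chi> i. F $ i - mvar i - exp_tail X i)" for X
  define Z where "Z d = (T ^^ d) 0" for d
  have T: "T X \<in> formal_vector_fields n" if "X \<in> formal_vector_fields n" for X
    using F [unfolded formal_diffeos_order_iff[OF n]] mord_exp_tail_ge[OF that]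
    by (simp add: T_def formal_vector_fields_def mord_ge_iff del: mvar.rep_eq)
  have sub: "formal_vector_fields n \<subseteq> formal_vector_fields 2"
    using n by (rule formal_vector_fields_antimono)
  have agree_T: "agree (Suc d) (T X $ i) (T Y $ i)"
    if "X \<in> formal_vector_fields n" "Y \<in> formal_vector_fields n" "\<And>k. agree d (X $ k) (Y $ k)"
    for d X Y i
    using agree_exp_tail[of X Y d i] that sub by (auto simp: T_def agree_def)
  have Z: "Z d \<in> formal_vector_fields n" for d
    by (induction d) (auto simp: Z_def T, simp add: formal_vector_fields_def mord_ge_iff)
  have Z_Suc: "\<forall>i. agree d (Z d $ i) (Z (Suc d) $ i)" for d
  proof (induction d)
    case (Suc d)
    then have "agree (Suc d) (T (Z d) $ i) (T (Z (Suc d)) $ i)" for i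
      using Z by (intro agree_T) auto
    then show ?case by (simp add: Z_def)
  qed (simp add: agree_def)
  have Z_le: "agree d (Z d $ i) (Z e $ i)" if "d \<le> e" for d e i
    using that
  proof (induction e rule: dec_induct)
    case (step e)
    then show ?case using Z_Suc[of e] by (auto simp: agree_def)
  qed (simp add: agree_def)
  \<comment> \<open>Since \<open>agree\<close> is strict in the degree, a coefficient of degree
    \<open>d\<close> is stable from iterate \<open>d + 1\<close> on.\<close>
  define X where "X = (\<chi> i. Abs_mfps (\<lambda>\<alpha>. mcoeff (Z (Suc (mdeg \<alpha>)) $ i) \<alpha>))"
  have XZ: "agree d (X $ i) (Z d $ i)" for d i
    unfolding agree_def
  proof (intro allI impI)
    fix \<alpha> :: "nat ^ 'a" assume "mdeg \<alpha> < d"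
    then show "mcoeff (X $ i) \<alpha> = mcoeff (Z d $ i) \<alpha>"
      using Z_le[of "Suc (mdeg \<alpha>)" d i] by (simp add: X_def agree_def)
  qed
  have X: "X \<in> formal_vector_fields n"
    using Z by (auto simp: X_def formal_vector_fields_def mord_ge_iff)
  \<comment> \<open>Both sides agree with \<open>Z (Suc d) = T (Z d)\<close> below degree
    \<open>d + 1\<close>.\<close>
  have "agree (Suc d) (T X $ i) (X $ i)" for d i
    using agree_T[OF X Z XZ, of d i] XZ[of "Suc d" i] by (simp add: Z_def agree_def)
  then have "T X $ i = X $ i" for i
    by (intro mfps_eqI) (metis agree_def lessI)
  then have "Exp X $ i = F $ i" for i
    using Exp_eq[of X i] X sub by (auto simp: T_def algebra_simps)
  then have "Exp X = F" by (simp add: vec_eq_iff)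
  with X show ?thesis by blast
qed

section \<open>The Gevrey estimate\<close>

text \<open>The inverse square makes convolutions of weights reproduce the weight up to a constant.
  The index \<open>r\<close> belongs to degree \<open>r + 1\<close>.\<close>

definition gevrey_weight :: "real \<Rightarrow> nat \<Rightarrow> real" where
  "gevrey_weight s r = fact r powr s / (real r + 1)\<^sup>2"

lemma gevrey_weight_pos: "gevrey_weight s r > 0"
  by (simp add: gevrey_weight_def)

text \<open>A telescoping comparison; the term subtracted on the right is what lets the induction
  close.\<close>

lemma sum_inverse_squares_le: "(\<Sum>q\<le>r. 1 / (real q + 1)\<^sup>2) \<le> 2 - 1 / (real r + 1)"
proof (induction r)
  case (Suc r)
  have "1 / (real r + 2)\<^sup>2 \<le> 1 / ((real r + 1) * (real r + 2))"
    by (intro divide_left_mono) (auto simp: power2_eq_square)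
  also have "\<dots> = 1 / (real r + 1) - 1 / (real r + 2)"
    by (simp add: divide_simps)
  finally show ?case using Suc by (simp add: add.commute)
qed simp

text \<open>From \<open>r + 1 \<le> a + b\<close> and \<open>(a + b)^2 \<le> 2 a^2 + 2 b^2\<close>
  the product splits into two sums of inverse squares, each at most 2 and each with factor
  2.\<close>

lemma sum_inverse_square_products_le:
  "(\<Sum>q\<le>r. (real r + 1)\<^sup>2 / ((real q + 1)\<^sup>2 * (real (r - q) + 1)\<^sup>2)) \<le> 8"
proof -
  have "(\<Sum>q\<le>r. (real r + 1)\<^sup>2 / ((real q + 1)\<^sup>2 * (real (r - q) + 1)\<^sup>2))
      \<le> (\<Sum>q\<le>r. 2 * (1 / (real q + 1)\<^sup>2) + 2 * (1 / (real (r - q) + 1)\<^sup>2))"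
  proof (intro sum_mono)
    fix q assume "q \<in> {..r}"
    define a b where "a = real q + 1" and "b = real (r - q) + 1"
    have ab: "a > 0" "b > 0" "real r + 1 \<le> a + b"
      using \<open>q \<in> {..r}\<close> by (auto simp: a_def b_def of_nat_diff)
    have "(real r + 1)\<^sup>2 \<le> (a + b)\<^sup>2" using ab by (intro power_mono) auto
    also have "\<dots> \<le> 2 * a\<^sup>2 + 2 * b\<^sup>2"
      using zero_le_power2[of "a - b"] by (simp add: power2_eq_square algebra_simps)
    finally have "(real r + 1)\<^sup>2 / (a\<^sup>2 * b\<^sup>2) \<le> (2 * a\<^sup>2 + 2 * b\<^sup>2) / (a\<^sup>2 * b\<^sup>2)"
      by (intro divide_right_mono) auto
    also have "\<dots> = 2 * (1 / a\<^sup>2) + 2 * (1 / b\<^sup>2)"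
      using ab by (simp add: divide_simps)
    finally show "(real r + 1)\<^sup>2 / ((real q + 1)\<^sup>2 * (real (r - q) + 1)\<^sup>2)
        \<le> 2 * (1 / (real q + 1)\<^sup>2) + 2 * (1 / (real (r - q) + 1)\<^sup>2)"
      by (simp add: a_def b_def)
  qed
  also have "\<dots> = 2 * (\<Sum>q\<le>r. 1 / (real q + 1)\<^sup>2) + 2 * (\<Sum>q\<le>r. 1 / (real (r - q) + 1)\<^sup>2)"
    by (simp add: sum.distrib sum_distrib_left)
  also have "(\<Sum>q\<le>r. 1 / (real (r - q) + 1)\<^sup>2) = (\<Sum>q\<le>r. 1 / (real q + 1)\<^sup>2)"
    by (rule sum.reindex_bij_witness[where i = "\<lambda>q. r - q" and j = "\<lambda>q. r - q"]) auto
  also have "2 * (\<Sum>q\<le>r. 1 / (real q + 1)\<^sup>2) + 2 * (\<Sum>q\<le>r. 1 / (real q + 1)\<^sup>2) \<le> 8"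
    using sum_inverse_squares_le[of r] by (smt (verit) divide_nonneg_nonneg of_nat_0_le_iff)
  finally show ?thesis .
qed

text \<open>A row of Pascal's triangle is symmetric and rises up to its middle.\<close>

lemma binomial_le_binomial_between:
  assumes "p \<le> q" "p + q \<le> r"
  shows "r choose p \<le> r choose q"
proof (cases "2 * q \<le> r")
  case True
  then show ?thesis using assms by (intro binomial_mono) auto
next
  case False
  then have "r choose p \<le> r choose (r - q)" using assms by (intro binomial_mono) auto
  also have "\<dots> = r choose q" using assms by (subst binomial_symmetric) auto
  finally show ?thesis .
qed

text \<open>Here the order of the vector field pays for the derivative: the factor \<open>r - q + 1\<close> is
  at most \<open>2 * p * (r / p) powr (p * s)\<close>, hence is absorbed by the binomial coefficient.\<close>

lemma gevrey_weight_mult_le: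
  assumes p: "p \<ge> 1" "s \<ge> 1 / real p" and q: "p \<le> q" "p + q \<le> r"
  shows "gevrey_weight s q * (real (Suc (r - q)) * gevrey_weight s (r - q))
    \<le> 2 * real p * gevrey_weight s r * ((real r + 1)\<^sup>2 / ((real q + 1)\<^sup>2 * (real (r - q) + 1)\<^sup>2))"
proof -
  have s: "s > 0" using p by (smt (verit) divide_pos_pos of_nat_0_less_iff zero_less_one less_le_trans)
  have r: "real r / real p \<ge> 1" using p q by (simp add: divide_simps)
  \<comment> \<open>The base is at least 1, and \<open>s \<ge> 1 / p\<close> makes the exponent at
    least 1.\<close>
  have "real r / real p \<le> (real r / real p) powr (real p * s)"
    using powr_mono[of 1 "real p * s" "real r / real p"] p r by (simp add: field_simps)
  also have "\<dots> = ((real r / real p) ^ p) powr s"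
    using r p q by (simp add: powr_powr [symmetric] powr_realpow)
  also have "\<dots> \<le> real (r choose q) powr s"
  proof (rule powr_mono2)
    have "(real r / real p) ^ p \<le> real (r choose p)"
      using q by (intro binomial_ge_n_over_k_pow_k) auto
    also have "\<dots> \<le> real (r choose q)" using binomial_le_binomial_between[OF q] by simp
    finally show "(real r / real p) ^ p \<le> real (r choose q)" .
  qed (use s in auto)
  finally have b: "real r / real p \<le> real (r choose q) powr s" .
  have "real (Suc (r - q)) \<le> 2 * real r" using p q by (simp add: of_nat_diff)
  also have "\<dots> = 2 * real p * (real r / real p)" using p by simp
  also have "\<dots> \<le> 2 * real p * real (r choose q) powr s"
    using b by (intro mult_left_mono) auto
  finally have c: "real (Suc (r - q)) \<le> 2 * real p * real (r choose q) powr s" .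
  \<comment> \<open>The binomial power is exactly what converts the factorials of the two weights
    into that of \<open>gevrey_weight s r\<close>.\<close>
  have f: "(fact r :: real) = fact q * fact (r - q) * real (r choose q)"
    using binomial_fact_lemma[of q r] q by (metis le_add2 le_trans of_nat_fact of_nat_mult)
  have "gevrey_weight s q * (real (Suc (r - q)) * gevrey_weight s (r - q))
      \<le> gevrey_weight s q * ((2 * real p * real (r choose q) powr s) * gevrey_weight s (r - q))"
    using c by (intro mult_left_mono mult_right_mono) (auto simp: less_imp_le gevrey_weight_pos)
  also have "\<dots> = 2 * real p * gevrey_weight s r
      * ((real r + 1)\<^sup>2 / ((real q + 1)\<^sup>2 * (real (r - q) + 1)\<^sup>2))"
    by (simp add: gevrey_weight_def f powr_mult)
  finally show ?thesis .
qed

text \<open>The index range reflects two factors of order at least \<open>p + 1\<close>; the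
  constant is \<open>2 * 8\<close>.\<close>

lemma gevrey_weight_convolution:
  assumes p: "p \<ge> 1" "s \<ge> 1 / real p"
  shows "(\<Sum>q | p \<le> q \<and> p + q \<le> r. gevrey_weight s q * (real (Suc (r - q)) * gevrey_weight s (r - q)))
    \<le> 16 * real p * gevrey_weight s r"
proof -
  let ?t = "\<lambda>q. (real r + 1)\<^sup>2 / ((real q + 1)\<^sup>2 * (real (r - q) + 1)\<^sup>2)"
  let ?Q = "{q. p \<le> q \<and> p + q \<le> r}"
  have "(\<Sum>q\<in>?Q. gevrey_weight s q * (real (Suc (r - q)) * gevrey_weight s (r - q)))
      \<le> (\<Sum>q\<in>?Q. 2 * real p * gevrey_weight s r * ?t q)"
    by (intro sum_mono gevrey_weight_mult_le p) auto
  also have "\<dots> \<le> (\<Sum>q\<le>r. 2 * real p * gevrey_weight s r * ?t q)"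
    by (intro sum_mono2) (auto intro!: mult_nonneg_nonneg simp: less_imp_le gevrey_weight_pos)
  also have "\<dots> = 2 * real p * gevrey_weight s r * (\<Sum>q\<le>r. ?t q)"
    by (simp add: sum_distrib_left)
  also have "\<dots> \<le> 2 * real p * gevrey_weight s r * 8"
    by (intro mult_left_mono sum_inverse_square_products_le)
      (auto simp: less_imp_le gevrey_weight_pos)
  finally show ?thesis by simp
qed

text \<open>Bounds strictly below \<open>D\<close> yield a bound at \<open>D\<close> itself, because
  the vanishing low orders exclude the extreme indices. The powers of \<open>A\<close> multiply to
  \<open>A ^ r\<close>, so the new constant is independent of \<open>A\<close>.\<close>

lemma hnorm_vf_apply_gevrey:
  fixes X :: "'m::finite mfps ^ 'm"
  assumes p: "p \<ge> 1" "s \<ge> 1 / real p" and A: "A > 0" and c: "c \<ge> 0" "c' \<ge> 0"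
    and X: "X \<in> formal_vector_fields (Suc p)"
    and bX: "\<And>k q. q < D \<Longrightarrow> hnorm (Suc q) (X $ k) \<le> c * A ^ q * gevrey_weight s q"
    and g: "enat (Suc p) \<le> mord g"
    and bg: "\<And>q. q < D \<Longrightarrow> hnorm (Suc q) g \<le> c' * A ^ q * gevrey_weight s q"
    and r: "r \<le> D"
  shows "hnorm (Suc r) (vf_apply X g)
    \<le> c' * (c * (16 * real p * real CARD('m))) * A ^ r * gevrey_weight s r"
proof -
  let ?Q = "{q. p \<le> q \<and> p + q \<le> r}"
  let ?W = "gevrey_weight s"
  define \<xi> where "\<xi> q = (if p \<le> q then c * A ^ q * ?W q else 0)" for q
  have X0: "hnorm d (X $ k) = 0" if "d < Suc p" for d k
    using X that by (intro hnorm_eq_0[of "Suc p"]) (auto simp: formal_vector_fields_def)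
  have g0: "hnorm d g = 0" if "d < Suc p" for d
    using g that by (rule hnorm_eq_0)
  have "hnorm (Suc r) (vf_apply X g)
      \<le> real CARD('m) * (\<Sum>q\<le>r. \<xi> q * (real (Suc (r - q)) * hnorm (Suc (r - q)) g))"
  proof (rule hnorm_vf_apply)
    fix k q assume q: "q \<le> r" "hnorm (Suc q) (X $ k) \<noteq> 0" "hnorm (Suc (r - q)) g \<noteq> 0"
    \<comment> \<open>Together with \<open>p \<ge> 1\<close> and \<open>r \<le> D\<close> this gives
      \<open>q < D\<close>, where \<open>bX\<close> is available.\<close>
    then have "p \<le> q" "p \<le> r - q" using X0[of "Suc q" k] g0[of "Suc (r - q)"] by force+
    with q p r show "hnorm (Suc q) (X $ k) \<le> \<xi> q" by (auto simp: \<xi>_def intro!: bX)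
  qed (use X0 A c in \<open>auto simp: \<xi>_def less_imp_le gevrey_weight_pos\<close>)
  also have "(\<Sum>q\<le>r. \<xi> q * (real (Suc (r - q)) * hnorm (Suc (r - q)) g))
      = (\<Sum>q\<in>?Q. \<xi> q * (real (Suc (r - q)) * hnorm (Suc (r - q)) g))"
    by (intro sum.mono_neutral_right) (auto simp: \<xi>_def intro!: g0)
  also have "\<dots> \<le> (\<Sum>q\<in>?Q. c' * c * A ^ r * (?W q * (real (Suc (r - q)) * ?W (r - q))))"
  proof (intro sum_mono)
    fix q assume q: "q \<in> ?Q"
    have "\<xi> q * (real (Suc (r - q)) * hnorm (Suc (r - q)) g)
        \<le> (c * A ^ q * ?W q) * (real (Suc (r - q)) * (c' * A ^ (r - q) * ?W (r - q)))"
      using q p r c A unfolding \<xi>_def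
      by (intro mult_mono bg order_refl) (auto simp: less_imp_le gevrey_weight_pos)
    also have "\<dots> = c' * c * (A ^ q * A ^ (r - q)) * (?W q * (real (Suc (r - q)) * ?W (r - q)))"
      by (simp add: mult_ac)
    also have "A ^ q * A ^ (r - q) = A ^ r" using q by (simp flip: power_add)
    finally show "\<xi> q * (real (Suc (r - q)) * hnorm (Suc (r - q)) g)
        \<le> c' * c * A ^ r * (?W q * (real (Suc (r - q)) * ?W (r - q)))" .
  qed
  also have "\<dots> = c' * c * A ^ r * (\<Sum>q\<in>?Q. ?W q * (real (Suc (r - q)) * ?W (r - q)))"
    by (simp add: sum_distrib_left)
  also have "\<dots> \<le> c' * c * A ^ r * (16 * real p * ?W r)"
    using c A by (intro mult_left_mono gevrey_weight_convolution p) auto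
  finally show ?thesis by (simp add: mult_ac)
qed

text \<open>The value of \<open>c\<close> makes the loss \<open>c * 16 * p * m\<close>, with
  \<open>m\<close> variables, equal to \<open>1 / 4\<close> per application of \<open>X\<close>; the
  geometric series then leaves half of \<open>c\<close>.\<close>

lemma hnorm_exp_tail_gevrey:
  fixes X :: "'m::finite mfps ^ 'm"
  assumes p: "p \<ge> 1" "s \<ge> 1 / real p" and A: "A > 0" and c: "c = 1 / (64 * real p * real CARD('m))"
    and X: "X \<in> formal_vector_fields (Suc p)"
    and bX: "\<And>k q. q < D \<Longrightarrow> hnorm (Suc q) (X $ k) \<le> c * A ^ q * gevrey_weight s q"
  shows "hnorm (Suc D) (exp_tail X i) \<le> c / 2 * A ^ D * gevrey_weight s D"
proof -
  let ?h = "\<lambda>j. (vf_apply X ^^ Suc j) (mvar i)"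
  let ?w = "A ^ D * gevrey_weight s D"
  have c0: "c > 0" using c p by simp
  have c': "c * (16 * real p * real CARD('m)) = 1 / 4" using c p by simp
  have ord: "enat (Suc p) \<le> mord (?h j)" for j
    using mord_vf_apply_ge[OF X] by simp
  have step: "hnorm (Suc r) (?h (Suc j)) \<le> c * (1 / 4) ^ Suc j * A ^ r * gevrey_weight s r"
    if "r \<le> D" "\<And>q. q < D \<Longrightarrow> hnorm (Suc q) (?h j) \<le> c * (1 / 4) ^ j * A ^ q * gevrey_weight s q"
    for r j
  proof -
    have "hnorm (Suc r) (vf_apply X (?h j))
      \<le> c * (1 / 4) ^ j * (c * (16 * real p * real CARD('m))) * A ^ r * gevrey_weight s r"
      using c0 by (intro hnorm_vf_apply_gevrey[OF p A _ _ X bX ord that(2) that(1)]) auto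
    then show ?thesis unfolding c' by (simp add: mult_ac)
  qed
  have low: "hnorm (Suc q) (?h j) \<le> c * (1 / 4) ^ j * A ^ q * gevrey_weight s q" if "q < D" for q j
    using that
  proof (induction j arbitrary: q)
    case 0
    then show ?case using bX by simp
  next
    case (Suc j)
    then show ?case by (intro step) auto
  qed
  \<comment> \<open>At the top index nothing is assumed on \<open>X\<close> itself, so only second
    and higher powers are bounded there; these are the ones in the tail.\<close>
  have high: "hnorm (Suc D) (?h (Suc j)) \<le> c * (1 / 4) ^ Suc j * ?w" for j
    using step[of D j] low by (simp add: mult_ac)
  have "hnorm (Suc D) (exp_tail X i)
      = (\<Sum>\<alpha> | mdeg \<alpha> = Suc D. norm (\<Sum>j\<in>{2..Suc D}. mcoeff ((vf_apply X ^^ j) (mvar i)) \<alpha> / fact j))"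
    unfolding hnorm_def exp_tail_def by (intro sum.cong) auto
  also have "\<dots> \<le> (\<Sum>\<alpha> | mdeg \<alpha> = Suc D. \<Sum>j\<in>{2..Suc D}. norm (mcoeff ((vf_apply X ^^ j) (mvar i)) \<alpha>))"
  \<comment> \<open>The factors \<open>1 / j!\<close> are simply bounded by 1.\<close>
  proof (intro sum_mono order_trans[OF norm_sum])
    fix \<alpha> j
    have "norm (mcoeff ((vf_apply X ^^ j) (mvar i)) \<alpha> / fact j)
        = norm (mcoeff ((vf_apply X ^^ j) (mvar i)) \<alpha>) / fact j"
      by (simp add: norm_divide)
    also have "\<dots> \<le> norm (mcoeff ((vf_apply X ^^ j) (mvar i)) \<alpha>) / 1"
      by (intro divide_left_mono) auto
    finally show "norm (mcoeff ((vf_apply X ^^ j) (mvar i)) \<alpha> / fact j)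
        \<le> norm (mcoeff ((vf_apply X ^^ j) (mvar i)) \<alpha>)" by simp
  qed
  also have "\<dots> = (\<Sum>j\<in>{2..Suc D}. hnorm (Suc D) ((vf_apply X ^^ j) (mvar i)))"
    unfolding hnorm_def by (rule sum.swap)
  also have "\<dots> = (\<Sum>j<D. hnorm (Suc D) (?h (Suc j)))"
  proof -
    have "{2..Suc D} = Suc ` Suc ` {..<D}"
      by (simp add: image_Suc_lessThan image_Suc_atLeastAtMost numeral_2_eq_2)
    then show ?thesis by (simp add: sum.reindex del: funpow.simps)
  qed
  also have "\<dots> \<le> (\<Sum>j<D. c * (1 / 4) ^ Suc j * ?w)"
    by (intro sum_mono high)
  also have "\<dots> = c / 4 * ?w * (\<Sum>j<D. (1 / 4) ^ j)"
    by (simp add: sum_distrib_left mult_ac)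
  also have "\<dots> \<le> c / 4 * ?w * 2"
  proof (intro mult_left_mono)
    show "(\<Sum>j<D. (1 / 4 :: real) ^ j) \<le> 2"
      by (subst geometric_sum) (auto simp: field_simps)
  qed (use c0 A in \<open>auto simp: less_imp_le gevrey_weight_pos\<close>)
  finally show ?thesis by simp
qed

text \<open>The constant \<open>c\<close> may be prescribed as small as desired, with
  \<open>A\<close> absorbing all the data. This works only for \<open>r \<ge> 1\<close>, since
  \<open>A ^ 0 = 1\<close>.\<close>

lemma gevrey_imp_weight_bound:
  assumes f: "\<And>k :: 'k::finite. f k \<in> gevrey s" and s: "s \<ge> 0" and c: "c > 0"
  shows "\<exists>A\<ge>1. \<forall>k r. r \<ge> 1 \<longrightarrow> hnorm (Suc r) (f k) \<le> c * A ^ r * gevrey_weight s r"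
proof -
  have "\<forall>k. \<exists>C B. B > 0 \<and> (\<forall>d. hnorm d (f k) \<le> C * B ^ d * fact d powr s)"
    using f by (simp add: gevrey_iff)
  then obtain C B where B: "\<And>k. B k > 0" and bd: "\<And>k d. hnorm d (f k) \<le> C k * B k ^ d * fact d powr s"
    by metis
  define C' where "C' = 1 + (\<Sum>k\<in>UNIV. \<bar>C k\<bar>)"
  define B' where "B' = 1 + (\<Sum>k\<in>UNIV. B k)"
  have C': "C' \<ge> 1" "C k \<le> C'" for k
    using member_le_sum[of k UNIV "\<lambda>k. \<bar>C k\<bar>"] by (auto simp: C'_def sum_nonneg)
  have B': "B' \<ge> 1" "B k \<le> B'" for k
    using member_le_sum[of k UNIV B] B by (auto simp: B'_def less_imp_le intro!: sum_nonneg)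
  \<comment> \<open>\<open>e ^ r\<close> pays for the passage from \<open>r!\<close> to
    \<open>(r + 1)!\<close> under the power \<open>s\<close> and for the square in the
    weight.\<close>
  define e where "e = (2 :: real) powr (s + 2)"
  have e: "e \<ge> 1" using s by (simp add: e_def ge_one_powr_ge_zero)
  \<comment> \<open>\<open>E\<close> trades the given constant for \<open>c\<close>; being at least
    1, it is bounded by \<open>E ^ r\<close>.\<close>
  define E where "E = max 1 (C' * B' / c)"
  have E: "E \<ge> 1" "C' * B' \<le> c * E"
    using c by (auto simp: E_def max_def field_simps)
  define A where "A = E * B' * e"
  have "A \<ge> 1"
    using E(1) B'(1) e by (simp add: A_def mult_ge1_I)
  moreover have "hnorm (Suc r) (f k) \<le> c * A ^ r * gevrey_weight s r" if r: "r \<ge> 1" for k r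
  proof -
    have "(real r + 1) \<le> 2 ^ r"
      using r by (induction r rule: nat_induct_at_least) auto
    then have "(real r + 1) powr (s + 2) \<le> (2 ^ r) powr (s + 2)"
      using s by (intro powr_mono2) auto
    also have "\<dots> = e ^ r"
      by (simp add: e_def powr_realpow [symmetric] powr_powr mult.commute)
    finally have er: "(real r + 1) powr s * (real r + 1)\<^sup>2 \<le> e ^ r"
      by (simp add: powr_add)
    have "hnorm (Suc r) (f k) \<le> C k * B k ^ Suc r * fact (Suc r) powr s"
      by (rule bd)
    also have "\<dots> \<le> C' * B' ^ Suc r * fact (Suc r) powr s"
      using C' B' B by (intro mult_mono power_mono) (auto simp: less_imp_le intro: order_trans[OF zero_le_one])
    also have "\<dots> = (C' * B') * B' ^ r * (((real r + 1) powr s * (real r + 1)\<^sup>2) * gevrey_weight s r)"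
      by (simp add: gevrey_weight_def powr_mult add.commute)
    also have "\<dots> \<le> (c * E) * B' ^ r * (e ^ r * gevrey_weight s r)"
      using E(1) B'(1) c e
      by (intro mult_mono[OF mult_right_mono[OF E(2)] mult_right_mono[OF er]])
        (auto simp: less_imp_le gevrey_weight_pos)
    also have "\<dots> \<le> (c * E ^ r) * B' ^ r * (e ^ r * gevrey_weight s r)"
      using E B'(1) c r e power_increasing[of 1 r E]
      by (intro mult_right_mono mult_left_mono) (auto simp: less_imp_le gevrey_weight_pos)
    also have "\<dots> = c * A ^ r * gevrey_weight s r"
      by (simp add: A_def power_mult_distrib)
    finally show ?thesis .
  qed
  ultimately show ?thesis by blast
qed

text \<open>The weight drops its denominator and the shift from \<open>r\<close> to degree
  \<open>r + 1\<close> only enlarges the right side; degree 0 is covered by the order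
  hypothesis.\<close>

lemma weight_bound_imp_gevrey:
  assumes f: "enat 1 \<le> mord f" and s: "s \<ge> 0" and A: "A \<ge> 1" and c: "c \<ge> 0"
    and bd: "\<And>r. hnorm (Suc r) f \<le> c * A ^ r * gevrey_weight s r"
  shows "f \<in> gevrey s"
proof -
  have "hnorm d f \<le> c * A ^ d * fact d powr s" for d
  proof (cases d)
    case 0
    then show ?thesis using hnorm_eq_0[OF f, of 0] c by simp
  next
    case (Suc r)
    have "gevrey_weight s r \<le> fact r powr s / 1"
      unfolding gevrey_weight_def by (intro divide_left_mono) auto
    also have "\<dots> \<le> fact (Suc r) powr s"
      using s fact_mono[of r "Suc r", where ?'a = real] by (simp del: fact_Suc, intro powr_mono2) auto
    finally have w: "gevrey_weight s r \<le> fact (Suc r) powr s" .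
    have "hnorm (Suc r) f \<le> c * A ^ r * gevrey_weight s r" by (rule bd)
    also have "\<dots> \<le> c * A ^ Suc r * fact (Suc r) powr s"
      using w A c by (intro mult_mono power_increasing) (auto simp: less_imp_le gevrey_weight_pos simp del: power_Suc fact_Suc)
    finally show ?thesis using Suc by simp
  qed
  with A show ?thesis unfolding gevrey_iff by (intro exI[of _ c] exI[of _ A]) auto
qed

section \<open>Closure properties of Gevrey series\<close>

lemma hnorm_uminus [simp]: "hnorm d (- f) = hnorm d f"
  by (simp add: hnorm_def)

lemma gevrey_uminus: "f \<in> gevrey s \<Longrightarrow> - f \<in> gevrey s"
  by (simp add: gevrey_iff)

lemma gevrey_add:
  assumes "f \<in> gevrey s" "g \<in> gevrey s"
  shows "f + g \<in> gevrey s"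
proof -
  from assms obtain C B C' B' where B: "B > 0" "B' > 0"
    and bd: "\<And>d. hnorm d f \<le> C * B ^ d * fact d powr s" "\<And>d. hnorm d g \<le> C' * B' ^ d * fact d powr s"
    unfolding gevrey_iff by blast
  have C: "C \<ge> 0" "C' \<ge> 0"
    using order_trans[OF hnorm_nonneg bd(1)[of 0]] order_trans[OF hnorm_nonneg bd(2)[of 0]] by auto
  have "hnorm d (f + g) \<le> (C + C') * max B B' ^ d * fact d powr s" for d
  proof -
    have "C * B ^ d * fact d powr s \<le> C * max B B' ^ d * fact d powr s"
      "C' * B' ^ d * fact d powr s \<le> C' * max B B' ^ d * fact d powr s"
      using B C by (auto intro!: mult_mono power_mono)
    with bd[of d] hnorm_add[of d f g] show ?thesis by (simp add: distrib_right)
  qed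
  moreover have "max B B' > 0" using B by simp
  ultimately show ?thesis unfolding gevrey_iff by blast
qed

lemma gevrey_diff: "f \<in> gevrey s \<Longrightarrow> g \<in> gevrey s \<Longrightarrow> f - g \<in> gevrey s"
  using gevrey_add[of f s "- g"] gevrey_uminus[of g s] by simp

lemma mvar_gevrey:
  assumes "s \<ge> 0"
  shows "mvar i \<in> gevrey s"
proof -
  have "hnorm d (mvar i) \<le> 1 * 1 ^ d" for d
    by (simp add: hnorm_def if_distrib[of norm] cong: if_cong)
  then have "mvar i \<in> convergent_mfps"
    unfolding convergent_mfps_iff by (intro exI[of _ 1]) auto
  then show ?thesis using assms by (rule convergent_imp_gevrey)
qed

text \<open>From \<open>X\<close> to \<open>Exp X\<close>, the tail estimate applies directly.
  Conversely \<open>Exp X - id\<close> is given half of the budget \<open>c\<close>; by strong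
  induction on the degree, the tail, which sees only lower degrees of \<open>X\<close>, takes the
  other half.\<close>

lemma Exp_gevrey_iff:
  fixes X :: "'m::finite mfps ^ 'm"
  assumes p: "p \<ge> 1" "s \<ge> 1 / real p" and X: "X \<in> formal_vector_fields (Suc p)"
  shows "(\<forall>i. Exp X $ i \<in> gevrey s) \<longleftrightarrow> (\<forall>i. X $ i \<in> gevrey s)"
proof -
  have s: "s \<ge> 0" using p(2) order_trans[of 0 "1 / real p" s] by simp
  have X2: "X \<in> formal_vector_fields 2"
    using formal_vector_fields_antimono[of 2 "Suc p"] X p by auto
  have ordX: "enat (Suc p) \<le> mord (X $ i)" for i
    using X by (simp add: formal_vector_fields_def)
  have le1: "enat 1 \<le> mord f" if "enat (Suc p) \<le> mord f" for f :: "'m mfps"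
    using that by (simp add: mord_ge_iff)
  define c where "c = 1 / (64 * real p * real CARD('m))"
  have c: "c > 0" using p by (simp add: c_def)
  note tail = hnorm_exp_tail_gevrey[OF p _ c_def X]
  show ?thesis
  proof
    assume gX: "\<forall>i. X $ i \<in> gevrey s"
    then obtain A where A: "A \<ge> 1"
      and bd: "\<And>k r. r \<ge> 1 \<Longrightarrow> hnorm (Suc r) (X $ k) \<le> c * A ^ r * gevrey_weight s r"
      using gevrey_imp_weight_bound[of "\<lambda>k. X $ k" s c] s c by blast
    \<comment> \<open>The missing index 0 concerns degree 1, where \<open>X\<close> vanishes because
      its order is at least 2.\<close>
    have bX: "hnorm (Suc r) (X $ k) \<le> c * A ^ r * gevrey_weight s r" for k r
    proof (cases "r \<ge> 1")
      case False
      then show ?thesis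
        using hnorm_eq_0[OF ordX, of "Suc r" k] p c A gevrey_weight_pos[of s r] by simp
    qed (rule bd)
    show "\<forall>i. Exp X $ i \<in> gevrey s"
    proof
      fix i
      have "exp_tail X i \<in> gevrey s"
        using A c bX by (intro weight_bound_imp_gevrey[OF le1[OF mord_exp_tail_ge[OF X]] s A, of "c / 2"] tail) auto
      with gX show "Exp X $ i \<in> gevrey s"
        unfolding Exp_eq[OF X2] by (intro gevrey_add mvar_gevrey s) auto
    qed
  next
    assume gF: "\<forall>i. Exp X $ i \<in> gevrey s"
    then have "Exp X $ i - mvar i \<in> gevrey s" for i
      by (intro gevrey_diff mvar_gevrey s) auto
    then obtain A where A: "A \<ge> 1"
      and bd: "\<And>k r. r \<ge> 1 \<Longrightarrow> hnorm (Suc r) (Exp X $ k - mvar k) \<le> c / 2 * A ^ r * gevrey_weight s r"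
      using gevrey_imp_weight_bound[of "\<lambda>k. Exp X $ k - mvar k" s "c / 2"] s c by auto
    have bX: "hnorm (Suc r) (X $ k) \<le> c * A ^ r * gevrey_weight s r" for k r
    proof (induction r arbitrary: k rule: less_induct)
      case (less r)
      show ?case
      proof (cases "r \<ge> 1")
        case False
        then show ?thesis
          using hnorm_eq_0[OF ordX, of "Suc r" k] p c A gevrey_weight_pos[of s r] by simp
      next
        case True
        have "X $ k = (Exp X $ k - mvar k) - exp_tail X k"
          by (simp add: Exp_eq[OF X2])
        then have "hnorm (Suc r) (X $ k) \<le> hnorm (Suc r) (Exp X $ k - mvar k) + hnorm (Suc r) (exp_tail X k)"
          using hnorm_diff by metis
        also have "\<dots> \<le> c / 2 * A ^ r * gevrey_weight s r + c / 2 * A ^ r * gevrey_weight s r"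
          using A less by (intro add_mono bd True tail) auto
        finally show ?thesis by simp
      qed
    qed
    show "\<forall>i. X $ i \<in> gevrey s"
      using weight_bound_imp_gevrey[OF le1[OF ordX] s A less_imp_le[OF c] bX] by blast
  qed
qed

section \<open>The Gevrey bijection and the analytic case\<close>

lemma bij_betw_Exp_gevrey:
  assumes n: "n \<ge> 2" and s: "s \<ge> 1 / (real n - 1)"
  shows "bij_betw Exp (gevrey_vector_fields n s :: ('m::finite mfps ^ 'm) set) (gevrey_diffeos (n - 1) s)"
proof -
  have iff: "(\<forall>i. Exp X $ i \<in> gevrey s) \<longleftrightarrow> (\<forall>i. X $ i \<in> gevrey s)"
    if "X \<in> formal_vector_fields n" for X :: "'m mfps ^ 'm"
    using that n s by (intro Exp_gevrey_iff[of "n - 1"]) (auto simp: of_nat_diff)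
  have "inj_on Exp (gevrey_vector_fields n s :: ('m mfps ^ 'm) set)"
    by (rule inj_on_subset[OF inj_on_Exp])
      (use formal_vector_fields_antimono[OF n] in \<open>auto simp: gevrey_vector_fields_def\<close>)
  moreover have "Exp ` gevrey_vector_fields n s = (gevrey_diffeos (n - 1) s :: ('m mfps ^ 'm) set)"
  proof (intro equalityI subsetI)
    fix F :: "'m mfps ^ 'm" assume "F \<in> Exp ` gevrey_vector_fields n s"
    then show "F \<in> gevrey_diffeos (n - 1) s"
      using Exp_in_formal_diffeos_order[OF n] iff
      by (auto simp: gevrey_vector_fields_def gevrey_diffeos_def)
  next
    fix F :: "'m mfps ^ 'm" assume F: "F \<in> gevrey_diffeos (n - 1) s"
    then obtain X where "X \<in> formal_vector_fields n" "Exp X = F"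
      using Exp_surj[OF n] by (auto simp: gevrey_diffeos_def)
    with F iff show "F \<in> Exp ` gevrey_vector_fields n s"
      by (force simp: gevrey_vector_fields_def gevrey_diffeos_def)
  qed
  ultimately show ?thesis by (simp add: bij_betw_def)
qed

lemma infinitesimal_generator_Exp:
  assumes "X \<in> formal_vector_fields 2"
  shows "infinitesimal_generator (Exp X) = X"
  unfolding infinitesimal_generator_def
  using assms inj_onD[OF inj_on_Exp] by (intro the_equality) auto

text \<open>For finite order \<open>p\<close> the bijection applies with \<open>n = p + 1\<close>
  and \<open>s = 1 / p\<close>, as convergent series are Gevrey for every \<open>s \<ge> 0\<close>.
  Infinite order means the identity, generated by the zero field.\<close>

lemma infinitesimal_generator_analytic:
  assumes F: "tangent_to_identity F" and conv: "\<forall>i. F $ i \<in> convergent_mfps"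
  shows "infinitesimal_generator F \<in> gevrey_vector_fields 2 (inverse_order (diffeo_order F))"
proof (cases "diffeo_order F")
  case (enat p)
  have p: "p \<ge> 1" using F enat by (simp add: tangent_to_identity_def one_enat_def)
  have "F \<in> gevrey_diffeos (Suc p - 1) (1 / real p)"
    using F enat conv
    by (auto simp: gevrey_diffeos_def formal_diffeos_order_def tangent_to_identity_def
        intro!: convergent_imp_gevrey)
  then obtain X where X: "X \<in> gevrey_vector_fields (Suc p) (1 / real p)" "Exp X = F"
    using bij_betw_Exp_gevrey[of "Suc p" "1 / real p"] p by (force simp: bij_betw_def)
  then have "X \<in> gevrey_vector_fields 2 (1 / real p)"
    using formal_vector_fields_antimono[of 2 "Suc p"] p by (auto simp: gevrey_vector_fields_def)
  moreover from this have "infinitesimal_generator F = X"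
    using infinitesimal_generator_Exp[of X] X by (simp add: gevrey_vector_fields_def)
  ultimately show ?thesis using enat by (simp add: inverse_order_def)
next
  case infinity
  have X: "(0 :: 'a mfps ^ 'a) \<in> formal_vector_fields 2"
    by (simp add: formal_vector_fields_def mord_ge_iff)
  have 0: "enat n \<le> mord (F $ i - mvar i)" if "n \<ge> 2" for n i
    using F infinity formal_diffeos_order_iff[OF that, of F]
    by (auto simp: formal_diffeos_order_def tangent_to_identity_def)
  have "F $ i = mvar i" for i
  proof (rule mfps_eqI)
    fix \<alpha> :: "nat ^ 'a"
    show "mcoeff (F $ i) \<alpha> = mcoeff (mvar i) \<alpha>"
      using 0[of "mdeg \<alpha> + 2" i] by (auto simp: mord_ge_iff)
  qed
  moreover have "exp_tail 0 i = 0" for i :: 'a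
  proof (rule mfps_eqI)
    fix \<alpha> :: "nat ^ 'a"
    \<comment> \<open>The zero field has every order, in particular one exceeding the degree of
      \<alpha>.\<close>
    have "(0 :: 'a mfps ^ 'a) \<in> formal_vector_fields (Suc (mdeg \<alpha>))"
      by (simp add: formal_vector_fields_def mord_ge_iff)
    from mord_exp_tail_ge[OF this, of i] show "mcoeff (exp_tail 0 i) \<alpha> = mcoeff 0 \<alpha>"
      by (simp add: mord_ge_iff)
  qed
  ultimately have "Exp 0 = F"
    using Exp_eq[OF X] by (simp add: vec_eq_iff)
  then have "infinitesimal_generator F = 0"
    using infinitesimal_generator_Exp[OF X] by simp
  moreover have "(0 :: 'a mfps) \<in> gevrey s" for s
    by (auto simp: gevrey_iff intro!: exI[of _ 1])
  ultimately show ?thesis using X by (simp add: gevrey_vector_fields_def)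
qed

theorem theorem1p1:
  shows "(\<forall>n \<ge> 2. \<forall>s :: real. s \<ge> 1 / (real n - 1) \<longrightarrow>
            bij_betw (Exp :: 'm::finite mfps ^ 'm \<Rightarrow> 'm mfps ^ 'm)
              (gevrey_vector_fields n s) (gevrey_diffeos (n - 1) s))
       \<and> (\<forall>F :: 'm mfps ^ 'm. tangent_to_identity F \<and> (\<forall>i. F $ i \<in> convergent_mfps) \<longrightarrow>
            infinitesimal_generator F \<in> gevrey_vector_fields 2 (inverse_order (diffeo_order F)))"
  using bij_betw_Exp_gevrey infinitesimal_generator_analytic by blast

end
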